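(* Let $\alpha$ be a concave modulus, let $f\in\mathrm{Diff}_+^{1,\alpha}(S^1)$ be an exceptional diffeomorphism, let $\{J_i\}_{i\in\mathbb Z}$ be a maximal wandering set for $f$, and let $\ell_i$ be the length of $J_i$. Suppose that $\ell_{i+1}/\ell_i\to 1$ as $i\to\infty$. Then there is a constant $A>0$ such that \[\frac{A}{i}\le \alpha(\ell_i)\quad\text{for all } i>0.\]
   Context: $S^1=\mathbb R/\mathbb Z$, and $|x-y|$ for $x,y\in S^1$ is the distance modulo $1$. A concave modulus is a homeomorphism $\alpha\colon[0,\infty)\to[0,\infty)$ that is concave. A function $g\colon S^1\to\mathbb R$ is $\alpha$-continuous if $\sup_{x\neq y}|g(x)-g(y)|/\alpha(|x-y|)<\infty$. $\mathrm{Diff}_+^{1,\alpha}(S^1)$ is the group of orientation-preserving $C^1$ diffeomorphisms of $S^1$ with $\alpha$-continuous derivative. An exceptional diffeomorphism is one with irrational rotation number having an exceptional minimal set $K$, i.e. a minimal closed invariant set homeomorphic to a Cantor set. A maximal wandering set for $f$ is a family $\{J_i\}_{i\in\mathbb Z}$ of pairwise disjoint open intervals in $S^1\setminus K$ with $f(J_i)=J_{i+1}$ for all $i$, such that any interval properly containing some $J_i$ meets $K$ (so each $J_i$ is a connected component of $S^1\setminus K$, up to endpoints conventions; the family is the $f$-orbit of one component and need not be unique). *)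

theory Defs
  imports "HOL-Analysis.Analysis"
begin

section \<open>The circle \<open>\<real>/\<int>\<close>\<close>

definition int_cong :: "real \<Rightarrow> real \<Rightarrow> bool" where
  "int_cong s t \<longleftrightarrow> s - t \<in> \<int>"

lemma equivp_int_cong: "equivp int_cong"
proof (rule equivpI)
  show "reflp int_cong" by (simp add: reflp_def int_cong_def)
  show "symp int_cong"
    unfolding symp_def int_cong_def by (metis Ints_minus minus_diff_eq)
  show "transp int_cong"
    unfolding transp_def int_cong_def by (metis Ints_add diff_add_cancel add_diff_eq)
qed

quotient_type circle = real / int_cong
  morphisms rep_circle to_circle
  by (rule equivp_int_cong)

lemma to_circle_eq_iff: "to_circle s = to_circle t \<longleftrightarrow> s - t \<in> \<int>"
  using circle.abs_eq_iff int_cong_def by simp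

lemma surj_to_circle: "surj to_circle"
  by (metis Quotient3_circle Quotient3_def surj_def)

text \<open>The distance modulo 1 is the distance of the difference to the nearest integer.\<close>

definition int_dist :: "real \<Rightarrow> real" where
  "int_dist t = \<bar>t - of_int (round t)\<bar>"

lemma int_dist_le: "int_dist t \<le> \<bar>t - of_int m\<bar>"
  unfolding int_dist_def by (rule round_diff_minimal)

lemma int_dist_add_int: "int_dist (t + of_int m) = int_dist t"
proof (rule antisym)
  show "int_dist (t + of_int m) \<le> int_dist t"
    using int_dist_le[of "t + of_int m" "round t + m"] by (simp add: int_dist_def)
  show "int_dist t \<le> int_dist (t + of_int m)"
    using int_dist_le[of t "round (t + of_int m) - m"] unfolding int_dist_def
    by (simp add: algebra_simps)
qed

lemma int_dist_minus: "int_dist (- t) = int_dist t"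
proof -
  have "int_dist (- s) \<le> int_dist s" for s
    using int_dist_le[of "- s" "- round s"] by (simp add: int_dist_def abs_minus_commute)
  from this[of t] this[of "- t"] show ?thesis by simp
qed

lemma int_dist_triangle: "int_dist (s + t) \<le> int_dist s + int_dist t"
  using int_dist_le[of "s + t" "round s + round t"] unfolding int_dist_def by simp

lemma int_dist_eq_0_iff: "int_dist t = 0 \<longleftrightarrow> t \<in> \<int>"
proof
  assume "int_dist t = 0"
  then have "t = of_int (round t)" by (simp add: int_dist_def)
  then show "t \<in> \<int>" by (metis Ints_of_int)
next
  assume "t \<in> \<int>"
  then show "int_dist t = 0" by (auto elim!: Ints_cases simp: int_dist_def)
qed

lemma int_cong_iff: "int_cong s t \<longleftrightarrow> (\<exists>m. s = t + of_int m)"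
  unfolding int_cong_def by (metis Ints_cases Ints_of_int add_diff_cancel_left' diff_add_cancel add.commute)

instantiation circle :: metric_space
begin

lift_definition dist_circle :: "circle \<Rightarrow> circle \<Rightarrow> real" is "\<lambda>s t. int_dist (s - t)"
proof -
  fix s s' t t' assume "int_cong s s'" "int_cong t t'"
  then obtain m n where "s = s' + of_int m" "t = t' + of_int n"
    by (auto simp: int_cong_iff)
  then have "s - t = (s' - t') + of_int (m - n)" by simp
  then show "int_dist (s - t) = int_dist (s' - t')" using int_dist_add_int by metis
qed

definition uniformity_circle :: "(circle \<times> circle) filter" where
  "uniformity_circle = (INF e\<in>{0<..}. principal {(x, y). dist x y < e})"

definition open_circle :: "circle set \<Rightarrow> bool" where
  "open_circle U \<longleftrightarrow> (\<forall>x\<in>U. \<forall>\<^sub>F (x', y) in uniformity. x' = x \<longrightarrow> y \<in> U)"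

instance
proof
  fix x y z :: circle
  show "dist x y = 0 \<longleftrightarrow> x = y"
    by transfer (simp add: int_dist_eq_0_iff int_cong_def)
  show "dist x y \<le> dist x z + dist y z"
  proof transfer
    fix x y z
    have "int_dist (z - y) = int_dist (y - z)"
      using int_dist_minus[of "y - z"] by simp
    then show "int_dist (x - y) \<le> int_dist (x - z) + int_dist (y - z)"
      using int_dist_triangle[of "x - z" "z - y"] by simp
  qed
qed (simp_all add: uniformity_circle_def open_circle_def)

end

lemma dist_to_circle: "dist (to_circle s) (to_circle t) = \<bar>(s - t) - of_int (round (s - t))\<bar>"
  by (simp add: dist_circle.abs_eq int_dist_def)


section \<open>Intervals in the circle\<close>

text \<open>The bound \<^prop>\<open>l \<le> 1\<close> makes the parametrisation of an open interval by a real
  interval injective; the whole circle is not an open interval in this sense.\<close>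

definition open_circle_interval :: "circle set \<Rightarrow> bool" where
  "open_circle_interval J \<longleftrightarrow> (\<exists>a l. 0 < l \<and> l \<le> 1 \<and> J = to_circle ` {a<..<a + l})"

text \<open>Arbitrary intervals, with or without endpoints.  The whole circle is included.\<close>

definition circle_interval :: "circle set \<Rightarrow> bool" where
  "circle_interval I \<longleftrightarrow> (\<exists>T::real set. is_interval T \<and> I = to_circle ` T)"

definition arc_length :: "circle set \<Rightarrow> real" where
  "arc_length J = measure lborel {t \<in> {0..<1}. to_circle t \<in> J}"

lemma arc_length_open_interval:
  assumes "0 < l" "l \<le> 1"
  shows "arc_length (to_circle ` {a<..<a + l}) = l"
proof -
  define b where "b = frac a"
  have b: "0 \<le> b" "b < 1" by (auto simp: b_def frac_lt_1)
  have ab: "a = b + of_int \<lfloor>a\<rfloor>" by (simp add: b_def frac_def)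
  let ?S = "{t \<in> {0..<1}. to_circle t \<in> to_circle ` {a<..<a + l}}"
  have iff: "to_circle t \<in> to_circle ` {a<..<a + l} \<longleftrightarrow> (\<exists>m::int. b < t + m \<and> t + m < b + l)" for t
  proof
    assume "to_circle t \<in> to_circle ` {a<..<a + l}"
    then obtain s where s: "a < s" "s < a + l" "t - s \<in> \<int>"
      by (auto simp: to_circle_eq_iff)
    then obtain k where "t - s = of_int k" by (auto elim: Ints_cases)
    then have "s - of_int \<lfloor>a\<rfloor> = t + of_int (- k - \<lfloor>a\<rfloor>)" by simp
    then show "\<exists>m::int. b < t + m \<and> t + m < b + l" using s(1,2) ab
      by (intro exI[of _ "- k - \<lfloor>a\<rfloor>"]) linarith
  next
    assume "\<exists>m::int. b < t + m \<and> t + m < b + l"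
    then obtain m :: int where m: "b < t + m" "t + m < b + l" by blast
    have "t - (t + of_int (m + \<lfloor>a\<rfloor>)) = of_int (- m - \<lfloor>a\<rfloor>)" by simp
    then have "to_circle t = to_circle (t + of_int (m + \<lfloor>a\<rfloor>))"
      unfolding to_circle_eq_iff by (metis Ints_of_int)
    moreover have "t + of_int (m + \<lfloor>a\<rfloor>) \<in> {a<..<a + l}" using m ab by simp
    ultimately show "to_circle t \<in> to_circle ` {a<..<a + l}" by blast
  qed
  show ?thesis
  proof (cases "b + l \<le> 1")
    case True
    have "?S = {b<..<b + l}"
    proof (intro set_eqI iffI)
      fix t assume "t \<in> ?S"
      then obtain m :: int where m: "0 \<le> t" "t < 1" "b < t + m" "t + m < b + l" using iff by auto
      then have "-1 < m" "m < 1" using b True by linarith+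
      then have "m = 0" by simp
      then show "t \<in> {b<..<b + l}" using m by simp
    next
      fix t assume "t \<in> {b<..<b + l}"
      then show "t \<in> ?S" using iff[of t] b True by (auto intro!: exI[of _ 0])
    qed
    then show ?thesis using assms by (simp add: arc_length_def)
  next
    case False
    have "?S = {b<..<1} \<union> {0..<b + l - 1}"
    proof (intro set_eqI iffI)
      fix t assume "t \<in> ?S"
      then obtain m :: int where m: "0 \<le> t" "t < 1" "b < t + m" "t + m < b + l" using iff by auto
      then have "-1 < m" "m < 2" using b assms by linarith+
      then have "m = 0 \<or> m = 1" by auto
      then show "t \<in> {b<..<1} \<union> {0..<b + l - 1}" using m by auto
    next
      fix t assume t: "t \<in> {b<..<1} \<union> {0..<b + l - 1}"
      then consider "t \<in> {b<..<1}" | "t \<in> {0..<b + l - 1}" by blast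
      then show "t \<in> ?S"
      proof cases
        case 1
        then show ?thesis using iff[of t] b False by (auto intro!: exI[of _ 0])
      next
        case 2
        then show ?thesis using iff[of t] b assms by (auto intro!: exI[of _ 1])
      qed
    qed
    moreover have "measure lborel ({b<..<1} \<union> {0..<b + l - 1})
        = measure lborel {b<..<1} + measure lborel {0..<b + l - 1}"
      using assms b False by (intro measure_Union) auto
    ultimately show ?thesis using b False by (simp add: arc_length_def)
  qed
qed


section \<open>Circle diffeomorphisms\<close>

definition is_lift :: "(real \<Rightarrow> real) \<Rightarrow> (circle \<Rightarrow> circle) \<Rightarrow> bool" where
  "is_lift F f \<longleftrightarrow> continuous_on UNIV F \<and> (\<forall>t. to_circle (F t) = f (to_circle t))"

definition orientation_preserving :: "(circle \<Rightarrow> circle) \<Rightarrow> bool" where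
  "orientation_preserving f \<longleftrightarrow> (\<exists>F. is_lift F f \<and> strict_mono F)"

text \<open>\<open>has_C1_derivative f g\<close>: the map \<open>f\<close> is \<open>C\<^sup>1\<close> and \<open>g\<close> is its derivative, regarded as a
  real function on the circle through the trivialisation of the tangent bundle by \<open>\<real>\<close>.\<close>

definition has_C1_derivative :: "(circle \<Rightarrow> circle) \<Rightarrow> (circle \<Rightarrow> real) \<Rightarrow> bool" where
  "has_C1_derivative f g \<longleftrightarrow> continuous_on UNIV g \<and>
     (\<exists>F. is_lift F f \<and> (\<forall>t. (F has_real_derivative g (to_circle t)) (at t)))"

definition C1_diffeo :: "(circle \<Rightarrow> circle) \<Rightarrow> bool" where
  "C1_diffeo f \<longleftrightarrow> bij f \<and> (\<exists>g. has_C1_derivative f g) \<and> (\<exists>h. has_C1_derivative (inv f) h)"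

definition concave_modulus :: "(real \<Rightarrow> real) \<Rightarrow> bool" where
  "concave_modulus \<alpha> \<longleftrightarrow> (\<exists>\<beta>. homeomorphism {0..} {0..} \<alpha> \<beta>) \<and> concave_on {0..} \<alpha>"

definition modulus_continuous :: "(real \<Rightarrow> real) \<Rightarrow> (circle \<Rightarrow> real) \<Rightarrow> bool" where
  "modulus_continuous \<alpha> g \<longleftrightarrow>
     bdd_above {\<bar>g x - g y\<bar> / \<alpha> (dist x y) | x y. x \<noteq> y}"

definition Diff_plus :: "(real \<Rightarrow> real) \<Rightarrow> (circle \<Rightarrow> circle) set" where
  "Diff_plus \<alpha> = {f. C1_diffeo f \<and> orientation_preserving f \<and>
     (\<exists>g. has_C1_derivative f g \<and> modulus_continuous \<alpha> g)}"


section \<open>Exceptional diffeomorphisms and wandering sets\<close>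

text \<open>For an orientation-preserving homeomorphism the limit exists, it does not depend on the
  base point, and two lifts differ by an integer, so the choices made here do not matter.\<close>

definition translation_number :: "(real \<Rightarrow> real) \<Rightarrow> real" where
  "translation_number F = lim (\<lambda>n. (F ^^ n) 0 / real n)"

definition rotation_number :: "(circle \<Rightarrow> circle) \<Rightarrow> circle" where
  "rotation_number f = to_circle (translation_number (SOME F. is_lift F f))"

definition irrational_rotation_number :: "(circle \<Rightarrow> circle) \<Rightarrow> bool" where
  "irrational_rotation_number f \<longleftrightarrow> rotation_number f \<notin> to_circle ` \<rat>"

definition minimal_set :: "('a::topological_space \<Rightarrow> 'a) \<Rightarrow> 'a set \<Rightarrow> bool" where
  "minimal_set f K \<longleftrightarrow> closed K \<and> K \<noteq> {} \<and> f ` K = K \<and>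
     (\<forall>C. closed C \<and> C \<noteq> {} \<and> f ` C = C \<and> C \<subseteq> K \<longrightarrow> C = K)"

text \<open>The middle-thirds set: the reals with a ternary expansion using only the digits 0 and 2.\<close>

definition cantor_ternary_set :: "real set" where
  "cantor_ternary_set = range (\<lambda>b :: nat \<Rightarrow> bool. \<Sum>n. (if b n then 2 else 0) / 3 ^ Suc n)"

definition exceptional_minimal_set :: "(circle \<Rightarrow> circle) \<Rightarrow> circle set \<Rightarrow> bool" where
  "exceptional_minimal_set f K \<longleftrightarrow> minimal_set f K \<and> K homeomorphic cantor_ternary_set"

definition exceptional :: "(circle \<Rightarrow> circle) \<Rightarrow> bool" where
  "exceptional f \<longleftrightarrow> irrational_rotation_number f \<and> (\<exists>K. exceptional_minimal_set f K)"

definition maximal_wandering_set ::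
    "(circle \<Rightarrow> circle) \<Rightarrow> circle set \<Rightarrow> (int \<Rightarrow> circle set) \<Rightarrow> bool" where
  "maximal_wandering_set f K J \<longleftrightarrow>
     disjoint_family J \<and>
     (\<forall>i. open_circle_interval (J i) \<and> J i \<subseteq> - K \<and> f ` J i = J (i + 1)) \<and>
     (\<forall>i I. circle_interval I \<and> J i \<subset> I \<longrightarrow> I \<inter> K \<noteq> {})"

end

theory Submission
  imports Defs
begin

text \<open>The ratio of consecutive lengths is, by the mean value theorem, a value of the derivative
  on the earlier interval.  The lengths tend to 0, and by minimality every point of the minimal set
  is a limit of points of the intervals; so the derivative is 1 on the minimal set.  An endpoint of
  each interval lies in that set by maximality, hence the ratio differs from 1 by at most
  \<open>C \<alpha>(l i)\<close>.  Concavity turns this into \<open>a (i + 1) \<ge> (1 - C a i) a i\<close> for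
  \<open>a i = \<alpha>(l i)\<close>, so \<open>1 / a i\<close> grows at most linearly.\<close>

section \<open>Lifts of circle maps\<close>

lemma dist_to_circle_le: "dist (to_circle s) (to_circle t) \<le> \<bar>s - t\<bar>"
  using int_dist_le[of "s - t" 0] by (simp add: dist_to_circle int_dist_def)

lemma continuous_on_to_circle: "continuous_on S to_circle"
proof (rule continuous_onI)
  fix x e :: real
  assume "0 < e"
  then show "\<exists>d>0. \<forall>x'\<in>S. dist x' x < d \<longrightarrow> dist (to_circle x') (to_circle x) \<le> e"
    by (intro exI[of _ e]) (auto simp: dist_real_def intro: order_trans[OF dist_to_circle_le])
qed

lemma compact_circle: "compact (UNIV :: circle set)"
proof -
  have "to_circle t \<in> to_circle ` {0..1}" for t
  proof -
    have "to_circle t = to_circle (frac t)"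
      by (simp add: to_circle_eq_iff frac_def)
    moreover have "frac t \<in> {0..1}"
      by (simp add: frac_lt_1 less_imp_le)
    ultimately show ?thesis by blast
  qed
  then have "(UNIV :: circle set) = to_circle ` {0..1}"
    using surj_to_circle by (metis UNIV_eq_I rangeE UNIV_I)
  then show ?thesis
    by (metis compact_continuous_image continuous_on_to_circle compact_Icc)
qed

text \<open>Shifting a representative by the nearest integer turns the circle distance into a real
  distance, so that continuity of a lift descends to the circle map.\<close>

lemma nearest_representative:
  obtains t where "to_circle t = y" "\<bar>t - s\<bar> = dist y (to_circle s)"
proof -
  obtain u where u: "y = to_circle u" using surj_to_circle by (metis surjD)
  let ?t = "u - of_int (round (u - s))"
  have "to_circle ?t = y" by (simp add: u to_circle_eq_iff)
  moreover have "\<bar>?t - s\<bar> = dist y (to_circle s)"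
    unfolding u dist_to_circle by (simp add: algebra_simps)
  ultimately show ?thesis by (rule that)
qed

lemma is_lift_continuous:
  assumes "is_lift F f"
  shows "continuous_on UNIV f"
proof (rule continuous_onI)
  fix x :: circle and e :: real
  assume e: "0 < e"
  obtain s where s: "x = to_circle s" using surj_to_circle by (metis surjD)
  have "continuous_on UNIV F" using assms by (simp add: is_lift_def)
  then obtain d where d: "d > 0" "\<And>t. \<bar>t - s\<bar> < d \<Longrightarrow> \<bar>F t - F s\<bar> < e"
    using e unfolding continuous_on_iff dist_real_def by (metis UNIV_I)
  have "dist (f y) (f x) \<le> e" if "dist y x < d" for y
  proof -
    obtain t where t: "to_circle t = y" "\<bar>t - s\<bar> = dist y (to_circle s)"
      by (rule nearest_representative)
    have "dist (f y) (f x) = dist (to_circle (F t)) (to_circle (F s))"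
      using assms s t by (simp add: is_lift_def)
    also have "\<dots> \<le> \<bar>F t - F s\<bar>" by (rule dist_to_circle_le)
    also have "\<dots> \<le> e" using d(2)[of t] t s that by simp
    finally show ?thesis .
  qed
  with d(1) show "\<exists>d>0. \<forall>x'\<in>UNIV. dist x' x < d \<longrightarrow> dist (f x') (f x) \<le> e" by blast
qed

lemma to_circle_eq_imp_eq:
  assumes "to_circle s = to_circle t" "\<bar>s - t\<bar> < 1"
  shows "s = t"
proof -
  have "s - t \<in> \<int>" using assms(1) by (simp add: to_circle_eq_iff)
  then show ?thesis using Ints_nonzero_abs_less1[of "s - t"] assms(2) by simp
qed

text \<open>The difference of two lifts is continuous and integer valued, and distinct integers are
  at least 1 apart.\<close>

lemma is_lift_unique:
  assumes "is_lift F f" "is_lift G f"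
  obtains c where "\<And>t. F t = G t + c"
proof -
  have int: "F t - G t \<in> \<int>" for t
    using assms by (simp add: is_lift_def flip: to_circle_eq_iff)
  have "(\<lambda>t. F t - G t) constant_on UNIV"
  proof (rule continuous_discrete_range_constant)
    show "continuous_on UNIV (\<lambda>t. F t - G t)"
      using assms by (intro continuous_on_diff) (auto simp: is_lift_def)
    fix x
    have "1 \<le> norm ((F y - G y) - (F x - G x))" if "F y - G y \<noteq> F x - G x" for y
      using that Ints_nonzero_abs_ge1[OF Ints_diff[OF int[of y] int[of x]]] by simp
    then show "\<exists>e>0. \<forall>y. y \<in> UNIV \<and> F y - G y \<noteq> F x - G x \<longrightarrow>
        e \<le> norm ((F y - G y) - (F x - G x))"
      by (intro exI[of _ 1]) auto
  qed simp
  then obtain c where "\<And>t. F t - G t = c" unfolding constant_on_def by blast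
  then have "\<And>t. F t = G t + c" by (simp add: algebra_simps)
  then show ?thesis by (rule that)
qed

text \<open>Orientation and differentiability may be witnessed by different lifts; this carries
  monotonicity over to the lift whose derivative is known.\<close>

lemma is_lift_strict_mono:
  assumes "is_lift F f" "orientation_preserving f"
  shows "strict_mono F"
proof -
  obtain G where G: "is_lift G f" "strict_mono G"
    using assms(2) by (auto simp: orientation_preserving_def)
  obtain c where "\<And>t. F t = G t + c" using is_lift_unique[OF assms(1) G(1)] by blast
  then show ?thesis using G(2) by (simp add: strict_mono_def)
qed

lemma strict_mono_image_greaterThanLessThan:
  fixes F :: "real \<Rightarrow> real"
  assumes "strict_mono F" "continuous_on UNIV F" "a \<le> b"
  shows "F ` {a<..<b} = {F a<..<F b}"
proof
  show "F ` {a<..<b} \<subseteq> {F a<..<F b}" using assms(1) by (auto simp: strict_mono_def)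
  show "{F a<..<F b} \<subseteq> F ` {a<..<b}"
  proof
    fix y assume y: "y \<in> {F a<..<F b}"
    then obtain x where x: "a \<le> x" "x \<le> b" "F x = y"
      using IVT'[of F a y b] assms by (auto intro: continuous_on_subset)
    then have "x \<noteq> a" "x \<noteq> b" using y by auto
    then show "y \<in> F ` {a<..<b}" using x by force
  qed
qed

lemma arc_length_image:
  assumes "inj f" "is_lift F f" "strict_mono F" "0 < l" "l \<le> 1"
  shows "arc_length (f ` to_circle ` {a<..<a + l}) = F (a + l) - F a"
proof -
  have cont: "continuous_on UNIV F" using assms(2) by (simp add: is_lift_def)
  have lt: "F a < F (a + l)" using assms by (simp add: strict_mono_def)
  have img: "F ` {a<..<a + l} = {F a<..<F (a + l)}"
    by (rule strict_mono_image_greaterThanLessThan) (use assms cont in auto)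
  \<comment> \<open>\<open>arc_length_open_interval\<close> applies only up to length 1. A longer
    image would contain two points that differ by 1, hence project to one point of the circle;
    injectivity of \<open>f\<close> excludes this, as their preimages are less than 1 apart.\<close>
  have le: "F (a + l) - F a \<le> 1"
  proof (rule ccontr)
    assume "\<not> ?thesis"
    then obtain e where e: "e > 0" "F a + e + 1 < F (a + l)"
      using dense[of 0 "F (a + l) - F a - 1"] by force
    then have "F a + e \<in> F ` {a<..<a + l}" "F a + e + 1 \<in> F ` {a<..<a + l}"
      unfolding img by auto
    then obtain s t where st: "s \<in> {a<..<a + l}" "F a + e = F s" "t \<in> {a<..<a + l}" "F a + e + 1 = F t"
      by (metis imageE)
    then have "to_circle (F s) = to_circle (F t)"
      by (metis Ints_1 add_diff_cancel_left' to_circle_eq_iff)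
    then have "to_circle s = to_circle t"
      using assms(1,2) by (auto simp: is_lift_def inj_def)
    moreover have "\<bar>s - t\<bar> < 1" using st assms(5) by auto
    ultimately have "s = t" by (rule to_circle_eq_imp_eq)
    then show False using st by simp
  qed
  have "f ` to_circle ` {a<..<a + l} = to_circle ` F ` {a<..<a + l}"
    using assms(2) by (auto simp: is_lift_def image_image)
  also have "\<dots> = to_circle ` {F a<..<F a + (F (a + l) - F a)}" by (simp add: img)
  finally show ?thesis
    using arc_length_open_interval[of "F (a + l) - F a" "F a"] lt le by simp
qed


section \<open>Limit sets and wandering intervals\<close>

text \<open>The limit set of a forward orbit is closed, nonempty by compactness, and invariant. The
  hypothesis \<open>lim\<close> places it inside \<open>K\<close>, so minimality makes it all of
  \<open>K\<close>.\<close>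

lemma omega_limit_eq_minimal_set:
  fixes f :: "'a::metric_space \<Rightarrow> 'a" and y :: "nat \<Rightarrow> 'a"
  assumes "compact (UNIV :: 'a set)" "bij f" "continuous_on UNIV f" "continuous_on UNIV (inv f)"
    and "minimal_set f K"
    and orbit: "\<And>n. f (y n) = y (Suc n)"
    and lim: "\<And>z r. strict_mono r \<Longrightarrow> (y \<circ> r) \<longlonglongrightarrow> z \<Longrightarrow> z \<in> K"
    and "z \<in> K"
  obtains r where "strict_mono r" "(y \<circ> r) \<longlonglongrightarrow> z"
proof -
  define C where "C = (\<Inter>n. closure (y ` {n..}))"
  have img: "f ` closure S = closure (f ` S)" for S
  proof
    show "f ` closure S \<subseteq> closure (f ` S)"
      by (rule image_closure_subset[OF continuous_on_subset[OF assms(3)]])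
        (auto intro: subsetD[OF closure_subset])
    have "closed (f ` closure S)"
      using assms(1,3) by (metis closed_Int_compact closed_closure compact_continuous_image
          compact_imp_closed continuous_on_subset inf_top.right_neutral subset_UNIV)
    then show "closure (f ` S) \<subseteq> f ` closure S"
      by (rule closure_minimal[rotated]) (intro image_mono closure_subset)
  qed
  have sub: "\<exists>r. strict_mono r \<and> (y \<circ> r) \<longlonglongrightarrow> c" if "c \<in> C" for c
  proof -
    have "\<exists>m\<ge>n. dist (y m) c < e" if "e > 0" for n e
      using \<open>c \<in> C\<close> that by (auto simp: C_def closure_approachable)
    then have "\<exists>m\<ge>n. dist (y m) c < inverse (Suc k)" for n k by simp
    then have *: "\<exists>m>n. dist (y m) c < inverse (Suc k)" for n k
      by (meson Suc_le_lessD)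
    \<comment> \<open>Each index is chosen beyond the previous one and closer to \<open>c\<close>.
      The choice of \<open>r 0\<close> is not controlled by \<open>step\<close>, so convergence is
      first shown for the shifted sequence.\<close>
    define r where "r = rec_nat (SOME m. dist (y m) c < 1)
      (\<lambda>k n. SOME m. m > n \<and> dist (y m) c < inverse (Suc (Suc k)))"
    have step: "r (Suc k) > r k \<and> dist (y (r (Suc k))) c < inverse (Suc (Suc k))" for k
      using someI_ex[OF *[of "r k" "Suc k"]] by (simp add: r_def)
    then have "strict_mono r" by (simp add: strict_mono_Suc_iff)
    moreover have "(\<lambda>k. y (r (Suc k))) \<longlonglongrightarrow> c"
    proof (rule tendsto_dist_iff[THEN iffD2], rule tendsto_sandwich[OF _ _ tendsto_const])
      show "\<forall>\<^sub>F k in sequentially. dist (y (r (Suc k))) c \<le> inverse (real (Suc (Suc k)))"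
        using step by (simp add: less_imp_le)
      show "(\<lambda>k. inverse (real (Suc (Suc k)))) \<longlonglongrightarrow> 0"
        using LIMSEQ_Suc[OF LIMSEQ_inverse_real_of_nat] by simp
    qed auto
    then have "(y \<circ> r) \<longlonglongrightarrow> c" by (simp add: o_def filterlim_sequentially_Suc[of "\<lambda>k. y (r k)"])
    ultimately show ?thesis by blast
  qed
  have "C \<subseteq> K" using sub lim by blast
  moreover have "closed C" by (simp add: C_def closed_INT)
  moreover have "C \<noteq> {}"
  proof -
    obtain c r where cr: "strict_mono r" "(y \<circ> r) \<longlonglongrightarrow> c"
      using assms(1) unfolding compact_def by (metis UNIV_I)
    have "c \<in> closure (y ` {n..})" for n
    proof (rule Lim_in_closed_set[OF closed_closure _ _ cr(2)])
      have "\<forall>\<^sub>F k in sequentially. k \<ge> n" by (rule eventually_ge_at_top)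
      then show "\<forall>\<^sub>F k in sequentially. (y \<circ> r) k \<in> closure (y ` {n..})"
      proof eventually_elim
        case (elim k)
        then have "r k \<in> {n..}" using seq_suble[OF cr(1), of k] by simp
        then show ?case using closure_subset by fastforce
      qed
    qed simp
    then show ?thesis by (auto simp: C_def)
  qed
  \<comment> \<open>Bijectivity moves \<open>f\<close> inside the intersection, where it takes each
    tail to the next. The tails are nested, so dropping the first one leaves the intersection
    unchanged.\<close>
  moreover have "f ` C = C"
  proof -
    have "Suc ` {n..} = {Suc n..}" for n
      using image_add_atLeast[of 1 n] by simp
    then have "f ` y ` {n..} = y ` {Suc n..}" for n
      by (metis (no_types, lifting) image_cong image_image orbit)
    then have "f ` C = (\<Inter>n. closure (y ` {Suc n..}))"
      unfolding C_def using assms(2) by (subst bij_image_INT) (auto simp: img)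
    also have "\<dots> = C"
    proof
      show "C \<subseteq> (\<Inter>n. closure (y ` {Suc n..}))" by (auto simp: C_def)
      have "closure (y ` {Suc n..}) \<subseteq> closure (y ` {n..})" for n
        by (intro closure_mono image_mono) auto
      then show "(\<Inter>n. closure (y ` {Suc n..})) \<subseteq> C" by (force simp: C_def)
    qed
    finally show ?thesis .
  qed
  ultimately have "C = K" using assms(5) by (simp add: minimal_set_def)
  then show ?thesis using sub \<open>z \<in> K\<close> that by blast
qed

section \<open>Lengths and endpoints of wandering intervals\<close>

text \<open>Disjoint arcs have total length at most 1, so the series of lengths converges.\<close>

lemma arc_length_disjoint_tendsto_0:
  fixes J :: "nat \<Rightarrow> circle set"
  assumes "disjoint_family J" "\<And>n. 0 < arc_length (J n)"
  shows "(\<lambda>n. arc_length (J n)) \<longlonglongrightarrow> 0"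
proof (rule summable_LIMSEQ_zero, rule summableI_nonneg_bounded)
  define S where "S n = {t \<in> {0..<1}. to_circle t \<in> J n}" for n
  have len: "arc_length (J n) = measure lborel (S n)" for n by (simp add: arc_length_def S_def)
  \<comment> \<open>Measurability comes from positive length: \<open>measure\<close> is 0 by
    convention on sets that are not measurable.\<close>
  have meas: "S n \<in> sets lborel" for n
    using assms(2)[of n] measure_notin_sets[of "S n" lborel] by (fastforce simp: len)
  show "(\<Sum>i<n. arc_length (J i)) \<le> 1" for n
  proof -
    have sub: "S i \<subseteq> {0..1}" for i by (auto simp: S_def)
    have fm: "S i \<in> fmeasurable lborel" for i
      by (rule fmeasurableI2[OF fmeasurable_cbox sub[folded cbox_interval] meas])
    have "(\<Sum>i<n. arc_length (J i)) = measure lborel (\<Union>i<n. S i)"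
      unfolding len
    proof (rule measure_finite_Union[symmetric])
      show "disjoint_family_on S {..<n}"
        using assms(1) by (fastforce simp: disjoint_family_on_def S_def)
      show "emeasure lborel (S i) \<noteq> \<infinity>" for i using fmeasurableD2[OF fm[of i]] by simp
    qed (use meas in auto)
    also have "\<dots> \<le> measure lborel {0..1::real}"
      using sub by (intro measure_mono_fmeasurable) (use meas fmeasurable_cbox[of 0 "1::real"] in auto)
    finally show ?thesis by simp
  qed
qed (use assms(2) less_imp_le in auto)

text \<open>Adjoining the left endpoint gives a strictly larger interval, which must meet
  \<open>K\<close> by maximality. Since \<open>J i\<close> misses \<open>K\<close>, it is the
  endpoint that lies in \<open>K\<close>.\<close>

lemma maximal_wandering_set_interval:
  assumes "maximal_wandering_set f K J"
  obtains a where "0 < arc_length (J i)" "arc_length (J i) \<le> 1"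
    "J i = to_circle ` {a<..<a + arc_length (J i)}" "to_circle a \<in> K"
proof -
  obtain a l where al: "0 < l" "l \<le> 1" "J i = to_circle ` {a<..<a + l}"
    using assms unfolding maximal_wandering_set_def open_circle_interval_def by metis
  \<comment> \<open>Length at most 1 keeps the open arc from wrapping around onto its own endpoint,
    so the enlargement is proper.\<close>
  have notin: "to_circle a \<notin> J i"
  proof
    assume "to_circle a \<in> J i"
    then obtain t where t: "to_circle a = to_circle t" "t \<in> {a<..<a + l}" using al by auto
    then have "a = t" using al by (intro to_circle_eq_imp_eq) auto
    then show False using t by simp
  qed
  have I: "to_circle ` {a..<a + l} = insert (to_circle a) (J i)"
  proof -
    have "{a..<a + l} = insert a {a<..<a + l}" using al by auto
    then show ?thesis using al by simp
  qed
  have "circle_interval (to_circle ` {a..<a + l})"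
    unfolding circle_interval_def by (blast intro: is_interval_co)
  then have "insert (to_circle a) (J i) \<inter> K \<noteq> {}"
    using assms notin unfolding I maximal_wandering_set_def by (metis psubset_insert_iff subset_insertI psubsetI insertI1)
  then have "to_circle a \<in> K"
    using assms unfolding maximal_wandering_set_def by blast
  moreover have "arc_length (J i) = l" using al arc_length_open_interval by simp
  ultimately show ?thesis using al that by metis
qed


section \<open>Concave moduli\<close>

lemma concave_modulus_nonneg:
  assumes "concave_modulus \<alpha>" "0 \<le> t"
  shows "0 \<le> \<alpha> t"
  using assms unfolding concave_modulus_def homeomorphism_def by auto

text \<open>This is concavity on the segment from 0 to \<open>t\<close>, with the nonnegative
  contribution of \<alpha> at 0 dropped.\<close>

lemma concave_modulus_scale:
  assumes "concave_modulus \<alpha>" "0 \<le> c" "c \<le> 1" "0 \<le> t"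
  shows "c * \<alpha> t \<le> \<alpha> (c * t)"
proof -
  have "(1 - c) * \<alpha> 0 + c * \<alpha> t \<le> \<alpha> ((1 - c) *\<^sub>R 0 + c *\<^sub>R t)"
    using assms unfolding concave_modulus_def
    by (intro concave_onD[of "{0..}"]) auto
  moreover have "0 \<le> (1 - c) * \<alpha> 0" using concave_modulus_nonneg[OF assms(1), of 0] assms by simp
  ultimately show ?thesis by simp
qed

text \<open>A decreasing chord of a concave function would reach negative values.\<close>

lemma concave_modulus_mono:
  assumes "concave_modulus \<alpha>" "0 \<le> s" "s \<le> t"
  shows "\<alpha> s \<le> \<alpha> t"
proof (rule ccontr)
  assume "\<not> ?thesis"
  then have lt: "\<alpha> t < \<alpha> s" and st: "s < t" using assms(3) by (auto simp: less_le)
  have pos: "0 < \<alpha> s" using concave_modulus_nonneg[OF assms(1), of t] assms lt by simp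
  \<comment> \<open>The weight \<open>c\<close> makes \<open>(1 - c) * \<alpha> s\<close> the
    midpoint of the two values, and \<open>u\<close> is the point beyond \<open>t\<close> for which
    \<open>t\<close> divides the segment from \<open>s\<close> to \<open>u\<close> with weight
    \<open>c\<close>. Nonnegativity at \<open>u\<close> then forces the value at \<open>t\<close> up
    to that midpoint.\<close>
  define c where "c = (\<alpha> s - \<alpha> t) / (2 * \<alpha> s)"
  define u where "u = s + (t - s) / c"
  have at: "0 \<le> \<alpha> t" using concave_modulus_nonneg[OF assms(1), of t] assms by simp
  have c: "0 < c" "c \<le> 1" using pos lt at by (auto simp: c_def)
  have u: "0 \<le> u" using assms c st by (simp add: u_def)
  have "(1 - c) * \<alpha> s + c * \<alpha> u \<le> \<alpha> ((1 - c) *\<^sub>R s + c *\<^sub>R u)"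
    using assms c u unfolding concave_modulus_def by (intro concave_onD[of "{0..}"]) auto
  also have "(1 - c) *\<^sub>R s + c *\<^sub>R u = t" using c by (simp add: u_def field_simps)
  finally have "(1 - c) * \<alpha> s \<le> \<alpha> t"
    using mult_nonneg_nonneg[OF less_imp_le[OF c(1)] concave_modulus_nonneg[OF assms(1) u]] by simp
  moreover have "(1 - c) * \<alpha> s = (\<alpha> s + \<alpha> t) / 2" using pos by (simp add: c_def field_simps)
  ultimately show False using lt by simp
qed

lemma concave_modulus_pos:
  assumes "concave_modulus \<alpha>" "0 < t"
  shows "0 < \<alpha> t"
proof -
  have "inj_on \<alpha> {0..}"
    using assms(1) unfolding concave_modulus_def by (metis homeomorphism_def inj_on_inverseI)
  then have "\<alpha> 0 \<noteq> \<alpha> t" using assms(2) inj_onD[of \<alpha> "{0..}" 0 t] by auto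
  then show ?thesis
    using concave_modulus_nonneg[OF assms(1), of 0] concave_modulus_mono[OF assms(1), of 0 t] assms(2) by simp
qed

lemma modulus_continuousE:
  assumes "concave_modulus \<alpha>" "modulus_continuous \<alpha> g"
  obtains C where "C > 0" "\<And>x y. \<bar>g x - g y\<bar> \<le> C * \<alpha> (dist x y)"
proof -
  obtain B where B: "\<And>x y. x \<noteq> y \<Longrightarrow> \<bar>g x - g y\<bar> / \<alpha> (dist x y) \<le> B"
    using assms(2) unfolding modulus_continuous_def bdd_above_def by blast
  \<comment> \<open>The maximum with 1 makes the constant positive.\<close>
  have "\<bar>g x - g y\<bar> \<le> max B 1 * \<alpha> (dist x y)" for x y
  proof (cases "x = y")
    case True
    then show ?thesis using concave_modulus_nonneg[OF assms(1), of 0] by simp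
  next
    case False
    then have p: "0 < \<alpha> (dist x y)" using concave_modulus_pos[OF assms(1)] by simp
    then have "\<bar>g x - g y\<bar> \<le> B * \<alpha> (dist x y)" using B[OF False] by (simp add: field_simps)
    also have "\<dots> \<le> max B 1 * \<alpha> (dist x y)" using p by (intro mult_right_mono) auto
    finally show ?thesis .
  qed
  then show ?thesis using that[of "max B 1"] by simp
qed

section \<open>From a quadratic recursion to a rate of decay\<close>

text \<open>While \<open>C * a n\<close> is at most 1/2, one step raises \<open>1 / a n\<close> by
  at most \<open>2 * C\<close>. Otherwise \<open>a n\<close> is large, and \<open>ratio\<close>
  keeps the next term above \<open>c / (2 * C)\<close>.\<close>

lemma inverse_linear_lower_bound:
  fixes a :: "nat \<Rightarrow> real"
  assumes pos: "\<And>n. 0 < a n" and "C > 0" "c > 0"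
    and step: "\<And>n. (1 - C * a n) * a n \<le> a (Suc n)"
    and ratio: "\<And>n. c * a n \<le> a (Suc n)"
  shows "\<exists>A>0. \<forall>n>0. A / real n \<le> a n"
proof -
  \<comment> \<open>The two entries cover the initial value and a restart after a large
    term.\<close>
  define M where "M = max (1 / a 0) (2 * C / c)"
  have M: "0 < M" using pos[of 0] by (simp add: M_def less_max_iff_disj)
  have bound: "1 / a n \<le> M + 2 * C * real n" for n
  proof (induction n)
    case 0
    then show ?case by (simp add: M_def)
  next
    case (Suc n)
    show ?case
    proof (cases "C * a n \<le> 1 / 2")
      case True
      have "1 / a (Suc n) \<le> 1 / ((1 - C * a n) * a n)"
        using step pos True by (intro divide_left_mono mult_pos_pos) auto
      also have "\<dots> \<le> 1 / a n + 2 * C"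
      proof -
        \<comment> \<open>With \<open>x = C * a n\<close>, this is the excess of
          \<open>(1 + 2 * x) * (1 - x)\<close> over 1.\<close>
        have "0 \<le> C * a n * (1 - 2 * (C * a n))"
          using True pos[of n] \<open>C > 0\<close> by (intro mult_nonneg_nonneg) auto
        then have "1 \<le> (1 + 2 * C * a n) * (1 - C * a n)" by (simp add: algebra_simps)
        then have "1 / (1 - C * a n) \<le> 1 + 2 * C * a n"
          using True by (simp add: pos_divide_le_eq)
        then have "1 / (1 - C * a n) / a n \<le> (1 + 2 * C * a n) / a n"
          using pos[of n] by (intro divide_right_mono) auto
        then show ?thesis using pos[of n] by (simp add: add_divide_distrib)
      qed
      finally show ?thesis using Suc by (simp add: algebra_simps)
    next
      case False
      then have "c / (2 * C) \<le> c * a n" using assms(2,3) by (simp add: field_simps)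
      then have "c / (2 * C) \<le> a (Suc n)" using ratio[of n] by linarith
      then have "1 / a (Suc n) \<le> 2 * C / c" using assms(2,3) pos[of "Suc n"] by (simp add: field_simps)
      also have "\<dots> \<le> M + 2 * C * real (Suc n)" using \<open>C > 0\<close> by (simp add: M_def add_increasing2)
      finally show ?thesis .
    qed
  qed
  have "1 / (M + 2 * C) / real n \<le> a n" if "n > 0" for n
  proof -
    have "1 / a n \<le> M + 2 * C * real n" by (rule bound)
    also have "\<dots> \<le> (M + 2 * C) * real n"
      using M that by (simp add: algebra_simps)
    finally have "1 / ((M + 2 * C) * real n) \<le> 1 / (1 / a n)"
      using pos[of n] M \<open>C > 0\<close> that by (intro divide_left_mono mult_pos_pos) auto
    then show ?thesis by simp
  qed
  then show ?thesis using M \<open>C > 0\<close> by (intro exI[of _ "1 / (M + 2 * C)"]) auto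
qed

section \<open>The derivative on the minimal set\<close>

lemma derivative_eq_1_on_minimal_set:
  fixes f :: "circle \<Rightarrow> circle" and g :: "circle \<Rightarrow> real"
  assumes "C1_diffeo f" "minimal_set f K" "continuous_on UNIV g"
    and arcs: "\<And>i. f ` J i = J (Suc i)"
    and l0: "l \<longlonglongrightarrow> 0"
    and near: "\<And>i. \<exists>x\<in>K. \<forall>y\<in>J i. dist y x \<le> l i"
    and mvt: "\<And>i. \<exists>y\<in>J i. g y = l (Suc i) / l i"
    and ratio: "(\<lambda>i. l (Suc i) / l i) \<longlonglongrightarrow> 1"
    and "z \<in> K"
  shows "g z = 1"
proof -
  have f: "bij f" "continuous_on UNIV f" "continuous_on UNIV (inv f)"
    using assms(1) by (auto simp: C1_diffeo_def has_C1_derivative_def intro: is_lift_continuous)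
  obtain x where x: "\<And>i. x i \<in> K" "\<And>i y. y \<in> J i \<Longrightarrow> dist y (x i) \<le> l i"
    using near by metis
  obtain w where w: "\<And>i. w i \<in> J i" "\<And>i. g (w i) = l (Suc i) / l i"
    using mvt by metis
  \<comment> \<open>The points \<open>w n\<close> control the derivative but need not form an orbit,
    as the limit set argument requires. The orbit \<open>y\<close> visits the same arcs, so both
    sequences stay within \<open>l n\<close> of \<open>x n\<close> and have the same subsequential
    limits.\<close>
  define y where "y n = (f ^^ n) (w 0)" for n
  have yJ: "y n \<in> J n" for n
  proof (induction n)
    case (Suc n)
    then have "f (y n) \<in> J (Suc n)" using arcs by blast
    then show ?case by (simp add: y_def)
  qed (simp add: y_def w)
  have dyx: "(\<lambda>n. dist (y n) (x n)) \<longlonglongrightarrow> 0"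
    by (rule tendsto_sandwich[OF _ _ tendsto_const l0]) (simp_all add: x yJ)
  have dwx: "(\<lambda>n. dist (w n) (x n)) \<longlonglongrightarrow> 0"
    by (rule tendsto_sandwich[OF _ _ tendsto_const l0]) (simp_all add: x w)
  have shift: "(v \<circ> r) \<longlonglongrightarrow> c"
    if "strict_mono r" "(u \<circ> r) \<longlonglongrightarrow> c" "(\<lambda>n. dist (u n) (x n)) \<longlonglongrightarrow> 0"
      "(\<lambda>n. dist (v n) (x n)) \<longlonglongrightarrow> 0" for u v r c
  proof (rule tendsto_dist_iff[THEN iffD2], rule tendsto_sandwich[OF _ _ tendsto_const])
    have "dist (v n) c \<le> dist (v n) (x n) + dist (u n) (x n) + dist (u n) c" for n
      by (metis add.commute add_right_mono dist_commute dist_triangle dist_triangle_le)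
    then show "\<forall>\<^sub>F n in sequentially. dist ((v \<circ> r) n) c
        \<le> dist (v (r n)) (x (r n)) + dist (u (r n)) (x (r n)) + dist ((u \<circ> r) n) c"
      by simp
    show "(\<lambda>n. dist (v (r n)) (x (r n)) + dist (u (r n)) (x (r n)) + dist ((u \<circ> r) n) c)
        \<longlonglongrightarrow> 0"
      using tendsto_add[OF tendsto_add[OF LIMSEQ_subseq_LIMSEQ[OF that(4,1)]
            LIMSEQ_subseq_LIMSEQ[OF that(3,1)]] tendsto_dist_iff[THEN iffD1, OF that(2)]]
      by (simp add: o_def)
  qed auto
  have "closed K" using assms(2) by (simp add: minimal_set_def)
  have lim: "c \<in> K" if "strict_mono r" "(y \<circ> r) \<longlonglongrightarrow> c" for c r
  proof (rule closed_sequentially[OF \<open>closed K\<close>])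
    \<comment> \<open>Replacing \<open>y\<close> by \<open>x\<close> exhibits the limit as one of
      points of the closed set \<open>K\<close>.\<close>
    show "(x \<circ> r) \<longlonglongrightarrow> c" by (rule shift[OF that dyx]) simp
  qed (simp add: x)
  obtain r where r: "strict_mono r" "(y \<circ> r) \<longlonglongrightarrow> z"
    by (rule omega_limit_eq_minimal_set[OF compact_circle f assms(2) _ lim \<open>z \<in> K\<close>])
      (simp_all add: y_def)
  have "(w \<circ> r) \<longlonglongrightarrow> z" by (rule shift[OF r dyx dwx])
  then have "(\<lambda>n. g ((w \<circ> r) n)) \<longlonglongrightarrow> g z"
    using assms(3) by (intro continuous_on_tendsto_compose[OF assms(3)]) (simp_all add: o_def)
  moreover have "(\<lambda>n. g ((w \<circ> r) n)) \<longlonglongrightarrow> 1"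
    using LIMSEQ_subseq_LIMSEQ[OF ratio r(1)] by (simp add: w o_def)
  ultimately show ?thesis by (rule LIMSEQ_unique)
qed

section \<open>Assembling the estimate along the forward orbit\<close>

theorem theorem1p4:
  fixes \<alpha> :: "real \<Rightarrow> real"
    and f :: "circle \<Rightarrow> circle"
    and K :: "circle set"
    and J :: "int \<Rightarrow> circle set"
    and l :: "int \<Rightarrow> real"
  assumes "concave_modulus \<alpha>"
    and "f \<in> Diff_plus \<alpha>"
    and "exceptional f"
    and "exceptional_minimal_set f K"
    and "maximal_wandering_set f K J"
    and "\<And>i. l i = arc_length (J i)"
    and "((\<lambda>i. l (i + 1) / l i) \<longlongrightarrow> 1) at_top"
  shows "\<exists>A>0. \<forall>i>0. A / real_of_int i \<le> \<alpha> (l i)"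
proof -
  obtain g where diffeo: "C1_diffeo f" "orientation_preserving f"
    and g: "has_C1_derivative f g" "modulus_continuous \<alpha> g"
    using assms(2) by (auto simp: Diff_plus_def)
  obtain F where g_cont: "continuous_on UNIV g" and F: "is_lift F f"
    and F': "\<And>t. (F has_real_derivative g (to_circle t)) (at t)"
    using g(1) by (auto simp: has_C1_derivative_def)
  have F_mono: "strict_mono F" using is_lift_strict_mono[OF F diffeo(2)] .
  have "inj f" using diffeo(1) by (auto simp: C1_diffeo_def bij_def)
  obtain C where C: "C > 0" "\<And>x y. \<bar>g x - g y\<bar> \<le> C * \<alpha> (dist x y)"
    using modulus_continuousE[OF assms(1) g(2)] by blast
  have "\<exists>a. 0 < l i \<and> l i \<le> 1 \<and> J i = to_circle ` {a<..<a + l i} \<and> to_circle a \<in> K" for i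
    using maximal_wandering_set_interval[OF assms(5), of i] unfolding assms(6) by metis
  then obtain a where l: "\<And>i. 0 < l i" "\<And>i. l i \<le> 1"
    and J: "\<And>i. J i = to_circle ` {a i<..<a i + l i}" and a: "\<And>i. to_circle (a i) \<in> K"
    by metis
  have fJ: "f ` J i = J (i + 1)" for i
    using assms(5) by (simp add: maximal_wandering_set_def)
  have near: "dist y (to_circle (a i)) \<le> l i" if "y \<in> J i" for i y
    using that dist_to_circle_le by (fastforce simp: J intro: order_trans)
  \<comment> \<open>The next length is the increment of the lift over the current interval, so the
    mean value theorem applies on the line.\<close>
  have mvt: "\<exists>y\<in>J i. g y = l (i + 1) / l i" for i
  proof -
    have "l (i + 1) = F (a i + l i) - F (a i)"
      using arc_length_image[OF \<open>inj f\<close> F F_mono l(1) l(2), of "a i" i] fJ[of i]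
      by (simp add: J[of i] assms(6)[of "i + 1"])
    moreover obtain t where "a i < t" "t < a i + l i"
      "F (a i + l i) - F (a i) = (a i + l i - a i) * g (to_circle t)"
      using MVT2[of "a i" "a i + l i" F "\<lambda>t. g (to_circle t)"] F' l(1)[of i] by auto
    ultimately show ?thesis using l(1)[of i] by (intro bexI[of _ "to_circle t"]) (auto simp: J)
  qed
  define L where "L n = l (int n)" for n
  have L_pos: "0 < L n" for n by (simp add: L_def l)
  have ratio: "(\<lambda>n. L (Suc n) / L n) \<longlonglongrightarrow> 1"
    using filterlim_compose[OF assms(7) filterlim_int_sequentially] by (simp add: L_def add.commute)
  have "disjoint_family (\<lambda>n. J (int n))"
    using assms(5) by (auto simp: maximal_wandering_set_def disjoint_family_on_def)
  then have L0: "L \<longlonglongrightarrow> 0"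
    using arc_length_disjoint_tendsto_0[of "\<lambda>n. J (int n)"] l(1) by (simp add: L_def[abs_def] assms(6))
  have g1: "g z = 1" if "z \<in> K" for z
  proof (rule derivative_eq_1_on_minimal_set[OF diffeo(1) _ g_cont _ L0 _ _ ratio that])
    show "minimal_set f K" using assms(4) by (simp add: exceptional_minimal_set_def)
    show "f ` J (int i) = J (int (Suc i))" for i using fJ[of "int i"] by (simp add: add.commute)
    show "\<exists>x\<in>K. \<forall>y\<in>J (int i). dist y x \<le> L i" for i
      using a near by (auto simp: L_def intro!: bexI[of _ "to_circle (a (int i))"])
    show "\<exists>y\<in>J (int i). g y = L (Suc i) / L i" for i
      using mvt[of "int i"] by (simp add: L_def add.commute)
  qed
  have diff: "1 - C * \<alpha> (L n) \<le> L (Suc n) / L n" for n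
  proof -
    let ?i = "int n"
    obtain y where y: "y \<in> J ?i" "g y = L (Suc n) / L n"
      using mvt[of ?i] by (auto simp: L_def add.commute)
    have "\<bar>g y - 1\<bar> \<le> C * \<alpha> (dist y (to_circle (a ?i)))"
      using C(2)[of y "to_circle (a ?i)"] g1[OF a] by simp
    also have "\<dots> \<le> C * \<alpha> (L n)"
      using C(1) near[OF y(1)] by (intro mult_left_mono concave_modulus_mono[OF assms(1)]) (auto simp: L_def)
    finally show ?thesis using y(2) by simp
  qed
  \<comment> \<open>A common form for both recursion hypotheses. The bound \<open>b \<le> 1\<close>
    is what \<open>concave_modulus_scale\<close> asks for, since the ratio itself may exceed 1;
    negative \<open>b\<close> occurs when \<open>C * \<alpha> (L n)\<close> exceeds 1, and then the
    left side is not positive.\<close>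
  have scale: "b * \<alpha> (L n) \<le> \<alpha> (L (Suc n))" if "b \<le> 1" "b \<le> L (Suc n) / L n" for b n
  proof (cases "0 \<le> b")
    case True
    have "b * \<alpha> (L n) \<le> \<alpha> (b * L n)"
      using concave_modulus_scale[OF assms(1) True that(1)] L_pos[of n] by simp
    also have "\<dots> \<le> \<alpha> (L (Suc n))"
      using that(2) True L_pos[of n]
      by (intro concave_modulus_mono[OF assms(1)]) (simp_all add: field_simps)
    finally show ?thesis .
  next
    case False
    then have "b * \<alpha> (L n) \<le> 0"
      using concave_modulus_pos[OF assms(1) L_pos[of n]] by (simp add: mult_le_0_iff)
    then show ?thesis using concave_modulus_pos[OF assms(1) L_pos[of "Suc n"]] by simp
  qed
  \<comment> \<open>Convergent inverse ratios are bounded, which bounds all ratios below by one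
    positive constant. This serves the indices at which \<open>C * \<alpha> (L n)\<close> is too
    large for the quadratic estimate.\<close>
  have "(\<lambda>n. inverse (L (Suc n) / L n)) \<longlonglongrightarrow> inverse 1"
    by (intro tendsto_inverse ratio) simp
  then have "Bseq (\<lambda>n. inverse (L (Suc n) / L n))" by (rule convergentI[THEN convergent_imp_Bseq])
  then obtain B where B: "B > 0" "\<And>n. inverse (L (Suc n) / L n) \<le> B"
    unfolding Bseq_def by (metis abs_le_D1 real_norm_def)
  have lower: "inverse B \<le> L (Suc n) / L n" for n
    using le_imp_inverse_le[OF B(2)[of n]] L_pos by simp
  have "\<exists>A>0. \<forall>n>0. A / real n \<le> \<alpha> (L n)"
  proof (rule inverse_linear_lower_bound)
    show "0 < \<alpha> (L n)" for n by (rule concave_modulus_pos[OF assms(1) L_pos])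
    show "(1 - C * \<alpha> (L n)) * \<alpha> (L n) \<le> \<alpha> (L (Suc n))" for n
      using C(1) concave_modulus_pos[OF assms(1) L_pos[of n]] by (intro scale diff) simp
    show "min 1 (inverse B) * \<alpha> (L n) \<le> \<alpha> (L (Suc n))" for n
      using lower[of n] by (intro scale) auto
  qed (use C(1) B(1) in auto)
  then obtain A where "A > 0" "\<And>n. n > 0 \<Longrightarrow> A / real n \<le> \<alpha> (L n)" by blast
  moreover have "A / real_of_int i \<le> \<alpha> (l i)" if "i > 0" "A / real (nat i) \<le> \<alpha> (L (nat i))" for i
    using that by (simp add: L_def)
  ultimately show ?thesis by (metis zero_less_nat_eq)
qed

end
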